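(* Let $\mathcal{H}$ and $\mathcal{K}$ be complex Hilbert spaces, let $T\in\mathcal{B}(\mathcal{H})$ have closed range, let $B\in\mathcal{B}(\mathcal{K},\mathcal{H})$ be injective with closed range, let $C\in\mathcal{B}(\mathcal{H},\mathcal{K})$ be surjective, and suppose $T=BC$. Then the following are equivalent: (1) $T$ is EP. (2) $B=C^{\dag}CB$ and $C=CBB^{\dag}$. (3) $B^{\dag}=B^{\dag}C^{\dag}C$ and $C=CBB^{\dag}$. (4) $B=C^{\dag}CB$ and $C^{\dag}=BB^{\dag}C^{\dag}$. (5) $B^{\dag}=B^{\dag}C^{\dag}C$ and $C^{\dag}=BB^{\dag}C^{\dag}$.
   Context: $\mathcal{B}(\mathcal{H},\mathcal{K})$ denotes the bounded linear operators from $\mathcal{H}$ to $\mathcal{K}$, and $\mathcal{B}(\mathcal{H})=\mathcal{B}(\mathcal{H},\mathcal{H})$. $\mathcal{N}(T)$ is the kernel of $T$ and $T^*$ its adjoint. An operator $T\in\mathcal{B}(\mathcal{H})$ with closed range is called EP if $\mathcal{N}(T)=\mathcal{N}(T^* )$. The Moore-Penrose inverse of an operator $S\in\mathcal{B}(\mathcal{H},\mathcal{K})$ with closed range is the unique $S^{\dag}\in\mathcal{B}(\mathcal{K},\mathcal{H})$ satisfying $SS^{\dag}S=S$, $S^{\dag}SS^{\dag}=S^{\dag}$, $(SS^{\dag})^*=SS^{\dag}$ and $(S^{\dag}S)^*=S^{\dag}S$. *)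

theory Defs
  imports "HOL-Analysis.Analysis"
begin

text \<open>
  The library has real but no complex Hilbert spaces. A complex inner product space is
  presented over its underlying real inner product space, whose inner product is the real
  part of the complex one; norm and topology are therefore those of the complex inner
  product. The complex inner product is linear in the first argument.
\<close>

class complex_inner = real_inner +
  fixes scaleC :: "complex \<Rightarrow> 'a \<Rightarrow> 'a"  (infixr "*\<^sub>C" 75)
    and cinner :: "'a \<Rightarrow> 'a \<Rightarrow> complex"
  assumes scaleC_add_right: "c *\<^sub>C (x + y) = c *\<^sub>C x + c *\<^sub>C y"
    and scaleC_add_left: "(c + d) *\<^sub>C x = c *\<^sub>C x + d *\<^sub>C x"
    and scaleC_scaleC: "c *\<^sub>C d *\<^sub>C x = (c * d) *\<^sub>C x"
    and scaleC_of_real: "complex_of_real r *\<^sub>C x = r *\<^sub>R x"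
    and cinner_commute: "cinner x y = cnj (cinner y x)"
    and cinner_add_left: "cinner (x + y) z = cinner x z + cinner y z"
    and cinner_scaleC_left: "cinner (c *\<^sub>C x) y = c * cinner x y"
    and Re_cinner: "Re (cinner x y) = x \<bullet> y"

class chilbert_space = complex_inner + complete_space

lemma scaleC_one: "1 *\<^sub>C x = (x::'a::complex_inner)"
  using scaleC_of_real[of 1 x] by simp

lemma cinner_self: "cinner x x = complex_of_real ((norm x)\<^sup>2)"
  for x :: "'a::complex_inner"
proof (rule complex_eqI)
  show "Re (cinner x x) = Re (complex_of_real ((norm x)\<^sup>2))"
    by (simp add: Re_cinner power2_norm_eq_inner)
  have "Im (cinner x x) = - Im (cinner x x)"
    using arg_cong[OF cinner_commute[of x x], of Im] by simp
  then show "Im (cinner x x) = Im (complex_of_real ((norm x)\<^sup>2))"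
    by simp
qed

instantiation complex :: chilbert_space
begin

definition scaleC_complex :: "complex \<Rightarrow> complex \<Rightarrow> complex"
  where "scaleC_complex c x = c * x"

definition cinner_complex :: "complex \<Rightarrow> complex \<Rightarrow> complex"
  where "cinner_complex x y = x * cnj y"

instance
  by standard
    (simp_all add: scaleC_complex_def cinner_complex_def algebra_simps
      scaleR_conv_of_real inner_complex_def)

end

definition bounded_clinear :: "('a::complex_inner \<Rightarrow> 'b::complex_inner) \<Rightarrow> bool"
  where "bounded_clinear S \<longleftrightarrow> bounded_linear S \<and> (\<forall>c x. S (c *\<^sub>C x) = c *\<^sub>C S x)"

definition null_space :: "('a::complex_inner \<Rightarrow> 'b::complex_inner) \<Rightarrow> 'a set"
  where "null_space S = {x. S x = 0}"

text \<open>Meaningful for bounded operators, for which the adjoint exists and is unique.\<close>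

definition adj :: "('a::chilbert_space \<Rightarrow> 'b::chilbert_space) \<Rightarrow> 'b \<Rightarrow> 'a"
  where "adj S = (THE R. bounded_clinear R \<and> (\<forall>x y. cinner (S x) y = cinner x (R y)))"

definition EP :: "('a::chilbert_space \<Rightarrow> 'a) \<Rightarrow> bool"
  where "EP T \<longleftrightarrow> bounded_clinear T \<and> closed (range T) \<and> null_space T = null_space (adj T)"

definition moore_penrose ::
    "('a::chilbert_space \<Rightarrow> 'b::chilbert_space) \<Rightarrow> ('b \<Rightarrow> 'a) \<Rightarrow> bool"
  where "moore_penrose S X \<longleftrightarrow> bounded_clinear X \<and>
    S \<circ> X \<circ> S = S \<and> X \<circ> S \<circ> X = X \<and>
    adj (S \<circ> X) = S \<circ> X \<and> adj (X \<circ> S) = X \<circ> S"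

text \<open>Meaningful for bounded operators with closed range, for which the Moore--Penrose
  inverse exists and is unique.\<close>

definition mp_inverse ::
    "('a::chilbert_space \<Rightarrow> 'b::chilbert_space) \<Rightarrow> 'b \<Rightarrow> 'a"  ("_\<^sup>\<dagger>" [1000] 999)
  where "S\<^sup>\<dagger> = (THE X. moore_penrose S X)"

end

theory Submission imports Defs begin

text \<open>
  Let \<open>P = B \<circ> B\<^sup>\<dagger>\<close> and \<open>Q = C\<^sup>\<dagger> \<circ> C\<close>, the orthogonal projections to the range of \<open>B\<close> and to
  the orthogonal complement of the null space of \<open>C\<close>. Since \<open>B\<close> is injective, the null space of
  \<open>T = B \<circ> C\<close> is that of \<open>C\<close>, hence that of \<open>Q\<close>; since \<open>C\<close> is surjective, the null space of
  the adjoint of \<open>T\<close>, the orthogonal complement of the range of \<open>T\<close>, is that of \<open>P\<close>. So \<open>T\<close> is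
  EP if and only if \<open>P\<close> and \<open>Q\<close> have the same null space. Each of the four identities expresses
  one of the two inclusions: \<open>B = C\<^sup>\<dagger> \<circ> C \<circ> B\<close> amounts to \<open>Q \<circ> P = P\<close> and
  \<open>B\<^sup>\<dagger> = B\<^sup>\<dagger> \<circ> C\<^sup>\<dagger> \<circ> C\<close> to \<open>P \<circ> Q = P\<close>, which are adjoint to one another and say that the null
  space of \<open>Q\<close> lies in that of \<open>P\<close> (lemmas \<open>projection_null_subset_iff\<close> and
  \<open>projection_absorb_commute\<close>). The identities for \<open>C\<close> and \<open>C\<^sup>\<dagger>\<close> give the opposite inclusion
  in the same way.

  For this the adjoint and the Moore--Penrose inverse must exist. Adjoints come from the Riesz
  representation theorem (\<open>riesz_on_closed_subspace\<close>), which also provides orthogonal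
  projections to closed subspaces. The Moore--Penrose inverse of an operator with closed range
  is assembled from such projections; its boundedness is the open mapping theorem
  (\<open>closed_range_bounded_preimages\<close>), a consequence of the Baire category theorem.
\<close>

section \<open>The Riesz representation theorem and adjoints\<close>

subclass (in chilbert_space) banach ..

text \<open>The representing vector is the minimiser of the quadratic functional
  \<open>\<lambda>z. z \<bullet> z - 2 * f z\<close> on \<open>M\<close>. Minimising sequences are Cauchy by the parallelogram law.
  For \<open>f = (\<lambda>x. x \<bullet> y)\<close> the vector is the orthogonal projection of \<open>y\<close> to \<open>M\<close>, for
  \<open>M = UNIV\<close> this is the usual representation theorem.\<close>

lemma riesz_on_closed_subspace:
  fixes f :: "'a::{real_inner,complete_space} \<Rightarrow> real"
  assumes M: "closed M" "subspace M" and f: "bounded_linear f"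
  obtains z where "z \<in> M" "\<And>x. x \<in> M \<Longrightarrow> f x = x \<bullet> z"
proof -
  interpret f: bounded_linear f by fact
  define J where "J z = z \<bullet> z - 2 * f z" for z
  define d where "d = Inf (J ` M)"
  obtain K where K: "\<And>x. norm (f x) \<le> norm x * K"
    using f.bounded by blast
  have bdd: "bdd_below (J ` M)"
  proof (rule bdd_belowI2)
    fix x :: 'a
    have "0 \<le> (norm x - K)\<^sup>2" by simp
    then have "- K\<^sup>2 \<le> x \<bullet> x - 2 * (norm x * K)"
      by (simp add: power2_diff flip: power2_norm_eq_inner)
    also have "\<dots> \<le> J x"
      using K[of x] by (simp add: J_def)
    finally show "- K\<^sup>2 \<le> J x" .
  qed
  have d_le: "d \<le> J x" if "x \<in> M" for x
    unfolding d_def using bdd that by (rule cINF_lower)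
  have "\<exists>x\<in>M. J x < d + 1 / real (Suc n)" for n
  proof (rule ccontr)
    assume "\<not> ?thesis"
    then have "d + 1 / real (Suc n) \<le> d"
      using subspace_0[OF M(2)] by (subst (2) d_def) (force intro!: cINF_greatest)
    then show False by simp
  qed
  then obtain z where zM: "\<And>n. z n \<in> M" and z: "\<And>n. J (z n) < d + 1 / real (Suc n)"
    by metis
  \<comment> \<open>The parallelogram law, with \<open>d \<le> J\<close> at the midpoint of \<open>a\<close> and \<open>b\<close>.\<close>
  have para: "(norm (a - b))\<^sup>2 \<le> 2 * (J a - d) + 2 * (J b - d)" if "a \<in> M" "b \<in> M" for a b
  proof -
    have "(1/2) *\<^sub>R (a + b) \<in> M"
      using that M(2) by (simp add: subspace_add subspace_scale)
    from d_le[OF this] have "d \<le> (1/4) * ((a + b) \<bullet> (a + b)) - f (a + b)"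
      by (simp add: J_def f.scaleR)
    then have "4 * d \<le> (a + b) \<bullet> (a + b) - 4 * f (a + b)" by simp
    then show ?thesis
      by (simp add: J_def power2_norm_eq_inner inner_simps f.add inner_commute)
  qed
  have "Cauchy z"
  proof (rule metric_CauchyI)
    fix e :: real assume "0 < e"
    then obtain N :: nat where N: "4 / e\<^sup>2 < real N"
      using reals_Archimedean2 by blast
    with \<open>0 < e\<close> have N0: "0 < N"
      by (metis divide_nonneg_nonneg gr0I not_less of_nat_0 zero_le_numeral zero_le_power2)
    have small: "J (z n) - d < e\<^sup>2 / 4" if "n \<ge> N" for n
    proof -
      have "J (z n) - d < 1 / real (Suc n)" using z[of n] by simp
      also have "\<dots> \<le> 1 / real N" using that N0 by (simp add: frac_le)
      also have "\<dots> < e\<^sup>2 / 4" using N N0 \<open>0 < e\<close> by (simp add: field_simps)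
      finally show ?thesis .
    qed
    have "dist (z m) (z n) < e" if "m \<ge> N" "n \<ge> N" for m n
    proof -
      have "(norm (z m - z n))\<^sup>2 < e\<^sup>2"
        using small[OF that(1)] small[OF that(2)] by (intro le_less_trans[OF para[OF zM zM]]) simp
      then show ?thesis
        using \<open>0 < e\<close> by (simp add: dist_norm power2_less_imp_less)
    qed
    then show "\<exists>N. \<forall>m\<ge>N. \<forall>n\<ge>N. dist (z m) (z n) < e" by blast
  qed
  then obtain l where l: "z \<longlonglongrightarrow> l"
    using Cauchy_convergent_iff convergent_def by blast
  have lM: "l \<in> M"
    using closed_sequentially[OF M(1) _ l] zM by blast
  have "(\<lambda>n. J (z n)) \<longlonglongrightarrow> J l"
    unfolding J_def by (intro tendsto_intros f.tendsto l)
  moreover have "(\<lambda>n. d + 1 / real (Suc n)) \<longlonglongrightarrow> d + 0"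
    using lim_inverse_n' by (intro tendsto_intros LIMSEQ_Suc)
  ultimately have Jl: "J l \<le> d + 0"
    by (rule LIMSEQ_le) (use z less_imp_le in blast)
  have "f x = x \<bullet> l" if x: "x \<in> M" for x
  proof -
    define r where "r = f x - x \<bullet> l"
    have ge: "0 \<le> t\<^sup>2 * (x \<bullet> x) - 2 * t * r" for t
    proof -
      have "l + t *\<^sub>R x \<in> M"
        using lM x M(2) by (simp add: subspace_add subspace_scale)
      from d_le[OF this] Jl have "J l \<le> J (l + t *\<^sub>R x)" by simp
      then show ?thesis
        by (simp add: J_def r_def inner_simps f.add f.scaleR inner_commute power2_eq_square
            algebra_simps)
    qed
    have "r = 0"
    proof (rule ccontr)
      assume "r \<noteq> 0"
      \<comment> \<open>The quadratic in \<open>t\<close> is negative at \<open>r / c\<close>; the summand 1 avoids dividing by 0.\<close>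
      define c where "c = x \<bullet> x + 1"
      have "c > 0" by (simp add: c_def add_nonneg_pos)
      define q where "q = r / c"
      have r: "r = q * c" and xx: "x \<bullet> x = c - 1" using \<open>c > 0\<close> by (simp_all add: q_def c_def)
      have "q\<^sup>2 * (x \<bullet> x) - 2 * q * r = - (q\<^sup>2 * (c + 1))"
        unfolding r xx by (simp add: power2_eq_square algebra_simps)
      also have "\<dots> < 0" using \<open>r \<noteq> 0\<close> \<open>c > 0\<close> r by simp
      finally show False using ge[of q] by simp
    qed
    then show ?thesis by (simp add: r_def)
  qed
  with lM show ?thesis using that by blast
qed

lemma inner_scaleC_left: "(c *\<^sub>C x) \<bullet> y = x \<bullet> (cnj c *\<^sub>C y)"
  for x y :: "'a::complex_inner"
proof -
  have "cinner x (cnj c *\<^sub>C y) = c * cinner x y"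
    by (metis cinner_commute cinner_scaleC_left complex_cnj_cnj complex_cnj_mult)
  then show ?thesis
    by (metis Re_cinner cinner_scaleC_left)
qed

text \<open>The imaginary part is again a real inner product, so an identity between complex inner
  products that is stable under multiplication by \<open>\<i>\<close> follows from its real part. This is why
  the real inner product suffices in what follows.\<close>

lemma Im_cinner: "Im (cinner x y) = - ((\<i> *\<^sub>C x) \<bullet> y)"
  for x y :: "'a::complex_inner"
  by (simp add: cinner_scaleC_left flip: Re_cinner)

lemma adjoint_unique:
  fixes R R' :: "'a::real_inner \<Rightarrow> 'b::real_inner"
  assumes "\<And>x y. S x \<bullet> y = x \<bullet> R y" "\<And>x y. S x \<bullet> y = x \<bullet> R' y"
  shows "R = R'"
  using assms by (metis ext vector_eq_ldot)

lemma bounded_clinear_adjoint: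
  fixes S :: "'a::complex_inner \<Rightarrow> 'b::complex_inner"
  assumes S: "bounded_clinear S" and adj: "\<And>x y. S x \<bullet> y = x \<bullet> R y"
  shows "bounded_clinear R"
proof -
  interpret S: bounded_linear S using S by (simp add: bounded_clinear_def)
  have SC: "S (c *\<^sub>C x) = c *\<^sub>C S x" for c x using S by (simp add: bounded_clinear_def)
  obtain K where K: "\<And>x. norm (S x) \<le> norm x * K" "K \<ge> 0"
    using S.nonneg_bounded by blast
  have "bounded_linear R"
  proof (rule bounded_linear_intro)
    show "R (x + y) = R x + R y" for x y
      by (rule vector_eq_ldot[THEN iffD1]) (simp add: inner_add_right flip: adj)
    show "R (r *\<^sub>R x) = r *\<^sub>R R x" for r x
      by (rule vector_eq_ldot[THEN iffD1]) (simp flip: adj)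
    show "norm (R y) \<le> norm y * K" for y
    proof (cases "R y = 0")
      case False
      have "norm (R y) * norm (R y) = S (R y) \<bullet> y"
        by (simp add: adj norm_eq_sqrt_inner)
      also have "\<dots> \<le> norm (S (R y)) * norm y" by (rule norm_cauchy_schwarz)
      also have "\<dots> \<le> (norm (R y) * K) * norm y" by (intro mult_right_mono K) simp
      finally show ?thesis using False by (simp add: mult.commute mult.left_commute)
    qed (simp add: K)
  qed
  moreover have "R (c *\<^sub>C y) = c *\<^sub>C R y" for c y
  proof (rule vector_eq_ldot[THEN iffD1], rule allI)
    fix x
    have "x \<bullet> R (c *\<^sub>C y) = S (cnj c *\<^sub>C x) \<bullet> y"
      by (simp add: SC inner_scaleC_left flip: adj)
    also have "\<dots> = x \<bullet> c *\<^sub>C R y"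
      by (simp add: adj inner_scaleC_left)
    finally show "x \<bullet> R (c *\<^sub>C y) = x \<bullet> c *\<^sub>C R y" .
  qed
  ultimately show ?thesis by (simp add: bounded_clinear_def)
qed

lemma adj_eqI:
  fixes S :: "'a::chilbert_space \<Rightarrow> 'b::chilbert_space"
  assumes S: "bounded_clinear S" and adj: "\<And>x y. S x \<bullet> y = x \<bullet> R y"
  shows "adj S = R"
  unfolding adj_def
proof (rule the_equality)
  have SC: "S (c *\<^sub>C x) = c *\<^sub>C S x" for c x using S by (simp add: bounded_clinear_def)
  have "cinner (S x) y = cinner x (R y)" for x y
    by (rule complex_eqI) (simp_all add: Re_cinner Im_cinner adj flip: SC)
  with bounded_clinear_adjoint[OF S adj]
  show "bounded_clinear R \<and> (\<forall>x y. cinner (S x) y = cinner x (R y))" by blast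
next
  fix R' assume "bounded_clinear R' \<and> (\<forall>x y. cinner (S x) y = cinner x (R' y))"
  then have "S x \<bullet> y = x \<bullet> R' y" for x y by (metis Re_cinner)
  then show "R' = R" using adj by (rule adjoint_unique)
qed

lemma inner_adj:
  fixes S :: "'a::chilbert_space \<Rightarrow> 'b::chilbert_space"
  assumes S: "bounded_clinear S"
  shows "S x \<bullet> y = x \<bullet> adj S y"
proof -
  have lin: "bounded_linear (\<lambda>x. S x \<bullet> y)" for y
    using S bounded_linear_compose[OF bounded_linear_inner_left]
    by (auto simp: bounded_clinear_def)
  have "\<exists>w. \<forall>x. S x \<bullet> y = x \<bullet> w" for y
    by (rule riesz_on_closed_subspace[OF closed_UNIV subspace_UNIV lin[of y]]) auto
  then obtain R where "\<And>x y. S x \<bullet> y = x \<bullet> R y" by metis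
  with adj_eqI[OF S] show ?thesis by metis
qed

section \<open>Operators with closed range\<close>

text \<open>A form of the open mapping theorem. By the Baire category theorem in the range, some closure
  of the image of a ball contains a ball of the range, so every \<open>u\<close> in the range is approximated
  up to half its norm by the image of a vector of norm at most \<open>M * norm u\<close>. Iterating on the
  error gives a convergent series of corrections.\<close>

lemma closed_range_bounded_preimages:
  fixes S :: "'a::banach \<Rightarrow> 'b::banach"
  assumes S: "bounded_linear S" and cl: "closed (range S)"
  obtains K where "\<And>y. y \<in> range S \<Longrightarrow> \<exists>x. S x = y \<and> norm x \<le> K * norm y"
proof -
  interpret S: bounded_linear S by fact
  let ?X = "top_of_set (range S)"
  define E where "E n = closure (S ` ball 0 (real n))" for n
  have ES: "E n \<subseteq> range S" for n
    unfolding E_def by (rule closure_minimal[OF _ cl]) auto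
  have UE: "\<Union>(range E) = range S"
  proof
    show "range S \<subseteq> \<Union>(range E)"
    proof
      fix y assume "y \<in> range S"
      then obtain x where x: "y = S x" by blast
      obtain n where "norm x < real n" using reals_Archimedean2 by blast
      then have "y \<in> E n" unfolding E_def x by (intro subsetD[OF closure_subset]) simp
      then show "y \<in> \<Union>(range E)" by blast
    qed
  qed (use ES in blast)
  have cm: "completely_metrizable_space ?X"
    using completely_metrizable_space_closedin[OF completely_metrizable_space_euclidean] cl
    by (metis closed_closedin)
  have "\<exists>n. ?X interior_of (E n) \<noteq> {}"
  proof (rule ccontr)
    assume "\<not> ?thesis"
    moreover have "closedin ?X (E n)" for n
      unfolding closedin_closed_eq[OF cl] using ES by (simp add: E_def)
    ultimately have "?X interior_of \<Union>(range E) = {}"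
      using cm by (intro Baire_category_alt) auto
    moreover have "?X interior_of \<Union>(range E) = range S"
      unfolding UE using interior_of_topspace[of ?X] by simp
    ultimately show False by blast
  qed
  then obtain n y where "y \<in> ?X interior_of (E n)" by blast
  then obtain U where U: "openin ?X U" "y \<in> U" "U \<subseteq> E n"
    by (auto simp: interior_of_def)
  then obtain e where e: "e > 0" "ball y e \<inter> range S \<subseteq> U"
    by (meson openin_contains_ball)
  have yE: "y \<in> E n" using U by blast
  have approx0: "\<exists>a. norm a \<le> 2 * real n \<and> norm (u - S a) < \<delta>"
    if u: "u \<in> range S" "norm u < e" and "\<delta> > 0" for u \<delta>
  proof -
    have "y + u \<in> range S"
      using yE ES u(1) by (metis rangeE rangeI S.add subsetD)
    moreover have "y + u \<in> ball y e" using u(2) by (simp add: dist_norm)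
    ultimately have yuE: "y + u \<in> E n" using e(2) U(3) by blast
    have near: "\<exists>a. norm a < real n \<and> dist (S a) v < \<delta> / 2" if "v \<in> E n" for v
    proof -
      have "\<delta> / 2 > 0" using \<open>\<delta> > 0\<close> by simp
      then have "\<exists>w\<in>S ` ball 0 (real n). dist w v < \<delta> / 2"
        using that unfolding E_def closure_approachable by blast
      then show ?thesis by auto
    qed
    obtain a where a: "norm a < real n" "dist (S a) (y + u) < \<delta> / 2"
      using near[OF yuE] by blast
    obtain b where b: "norm b < real n" "dist (S b) y < \<delta> / 2"
      using near[OF yE] by blast
    have diff: "u - S (a - b) = (S b - y) - (S a - (y + u))" by (simp add: S.diff)
    have "norm (u - S (a - b)) \<le> norm (S b - y) + norm (S a - (y + u))"
      unfolding diff by (rule norm_triangle_ineq4)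
    also have "\<dots> < \<delta>" using a b by (simp add: dist_norm)
    finally have "norm (u - S (a - b)) < \<delta>" .
    moreover have "norm (a - b) \<le> 2 * real n"
      using a b norm_triangle_ineq4[of a b] by linarith
    ultimately show ?thesis by blast
  qed
  define M where "M = 4 * real n / e"
  have "M \<ge> 0" using e by (simp add: M_def)
  have "\<exists>a. norm a \<le> M * norm u \<and> norm (u - S a) \<le> norm u / 2" if u: "u \<in> range S" for u
  proof (cases "u = 0")
    case True
    then show ?thesis by (intro exI[of _ 0]) simp
  next
    case False
    \<comment> \<open>Rescale \<open>u\<close> to norm \<open>e / 2\<close>.\<close>
    define s where "s = e / (2 * norm u)"
    have s: "s > 0" using e False by (simp add: s_def)
    have "s *\<^sub>R u \<in> range S" using u by (metis rangeE rangeI S.scaleR)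
    moreover have "norm (s *\<^sub>R u) < e" using e False by (simp add: s_def)
    moreover have "s * norm u / 2 > 0" using s False by simp
    ultimately obtain a where a: "norm a \<le> 2 * real n" "norm (s *\<^sub>R u - S a) < s * norm u / 2"
      using approx0 by blast
    have "norm ((1 / s) *\<^sub>R a) \<le> M * norm u"
      using a(1) s e False by (simp add: s_def M_def field_simps)
    moreover have "u - S ((1 / s) *\<^sub>R a) = (1 / s) *\<^sub>R (s *\<^sub>R u - S a)"
      using s by (simp add: S.scaleR scaleR_diff_right)
    then have "norm (u - S ((1 / s) *\<^sub>R a)) = norm (s *\<^sub>R u - S a) / s"
      using s by simp
    then have "norm (u - S ((1 / s) *\<^sub>R a)) \<le> norm u / 2"
      using less_imp_le[OF a(2)] s by (simp add: pos_divide_le_eq mult.commute)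
    ultimately show ?thesis by blast
  qed
  then obtain g where g: "\<And>u. u \<in> range S \<Longrightarrow> norm (g u) \<le> M * norm u"
      "\<And>u. u \<in> range S \<Longrightarrow> norm (u - S (g u)) \<le> norm u / 2"
    by metis
  have "\<exists>x. S x = y \<and> norm x \<le> (2 * M) * norm y" if y: "y \<in> range S" for y
  proof -
    \<comment> \<open>\<open>u k\<close> is the error left after \<open>k\<close> corrections.\<close>
    define u where "u k = ((\<lambda>u. u - S (g u)) ^^ k) y" for k
    have u0: "u 0 = y" and uS: "u (Suc k) = u k - S (g (u k))" for k by (simp_all add: u_def)
    have ur: "u k \<in> range S" for k
      by (induction k) (auto simp: u0 uS y simp flip: S.diff)
    have un: "norm (u k) \<le> norm y * (1/2) ^ k" for k
    proof (induction k)
      case (Suc k)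
      then show ?case using g(2)[OF ur[of k]] by (simp add: uS)
    qed (simp add: u0)
    have gn: "norm (g (u k)) \<le> M * norm y * (1/2) ^ k" for k
      using g(1)[OF ur[of k]] mult_left_mono[OF un[of k] \<open>M \<ge> 0\<close>] by (simp add: mult.assoc)
    have geo: "(\<lambda>k. M * norm y * (1/2) ^ k) sums (M * norm y * 2)"
      using sums_mult[OF geometric_sums[of "1/2::real"]] by simp
    have sn: "summable (\<lambda>k. norm (g (u k)))"
      using gn by (intro summable_comparison_test[OF _ sums_summable[OF geo]]) auto
    define x where "x = (\<Sum>k. g (u k))"
    have "norm x \<le> (\<Sum>k. norm (g (u k)))"
      unfolding x_def by (rule summable_norm[OF sn])
    also have "\<dots> \<le> M * norm y * 2"
      using suminf_le[OF gn sn sums_summable[OF geo]] sums_unique[OF geo] by simp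
    finally have nx: "norm x \<le> (2 * M) * norm y" by (simp add: mult_ac)
    have "u \<longlonglongrightarrow> 0"
    proof (rule Lim_null_comparison)
      show "(\<lambda>k. norm y * (1/2) ^ k) \<longlonglongrightarrow> 0"
        by (intro tendsto_mult_right_zero LIMSEQ_power_zero) simp
    qed (simp add: un)
    then have "(\<lambda>k. u k - u (Suc k)) sums (u 0 - 0)"
      by (rule telescope_sums')
    then have "(\<lambda>k. S (g (u k))) sums y" by (simp add: uS u0)
    moreover have "(\<lambda>k. S (g (u k))) sums S x"
      unfolding x_def by (intro S.sums summable_sums summable_norm_cancel[OF sn])
    ultimately have "S x = y" by (rule sums_unique2[THEN sym])
    with nx show ?thesis by blast
  qed
  then show ?thesis using that by blast
qed

section \<open>The Moore--Penrose inverse\<close>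

lemma bounded_clinear_compose:
  "bounded_clinear S \<Longrightarrow> bounded_clinear R \<Longrightarrow> bounded_clinear (S \<circ> R)"
  using bounded_linear_compose[of S R] by (auto simp: bounded_clinear_def comp_def)

text \<open>An operator equal to its adjoint is symmetric for the real inner product.\<close>

lemma moore_penrose_props:
  fixes S :: "'a::chilbert_space \<Rightarrow> 'b::chilbert_space"
  assumes S: "bounded_clinear S" and X: "moore_penrose S X"
  shows "bounded_clinear X" "S (X (S x)) = S x" "X (S (X y)) = X y"
    "S (X y) \<bullet> y' = y \<bullet> S (X y')" "X (S x) \<bullet> x' = x \<bullet> X (S x')"
proof -
  show Xl: "bounded_clinear X" using X by (simp add: moore_penrose_def)
  show "S (X (S x)) = S x" "X (S (X y)) = X y"
    using X by (auto simp: moore_penrose_def fun_eq_iff)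
  show "S (X y) \<bullet> y' = y \<bullet> S (X y')"
    using inner_adj[OF bounded_clinear_compose[OF S Xl], of y y'] X
    by (simp add: moore_penrose_def)
  show "X (S x) \<bullet> x' = x \<bullet> X (S x')"
    using inner_adj[OF bounded_clinear_compose[OF Xl S], of x x'] X
    by (simp add: moore_penrose_def)
qed

lemma moore_penrose_unique:
  fixes S :: "'a::chilbert_space \<Rightarrow> 'b::chilbert_space"
  assumes S: "bounded_clinear S" and X: "moore_penrose S X" and Y: "moore_penrose S Y"
  shows "X = Y"
proof -
  note x = moore_penrose_props[OF S X] and y = moore_penrose_props[OF S Y]
  have SX: "S (X v) = S (Y v)" for v
  proof (rule vector_eq_ldot[THEN iffD1], rule allI)
    fix w
    have "w \<bullet> S (X v) = S (Y (S (X w))) \<bullet> v" by (metis x(4) y(2))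
    also have "\<dots> = w \<bullet> S (X (S (Y v)))" by (metis x(4) y(4))
    also have "\<dots> = w \<bullet> S (Y v)" by (simp add: x(2))
    finally show "w \<bullet> S (X v) = w \<bullet> S (Y v)" .
  qed
  have XS: "X (S v) = Y (S v)" for v
  proof (rule vector_eq_ldot[THEN iffD1], rule allI)
    fix w
    have "w \<bullet> X (S v) = w \<bullet> X (S (Y (S v)))" by (simp add: y(2))
    also have "\<dots> = Y (S (X (S w))) \<bullet> v" by (metis x(5) y(5))
    also have "\<dots> = w \<bullet> Y (S v)" by (metis x(2) y(5))
    finally show "w \<bullet> X (S v) = w \<bullet> Y (S v)" .
  qed
  have "X v = Y v" for v
    by (metis XS SX x(3) y(3))
  then show ?thesis by blast
qed

text \<open>The inverse maps \<open>y\<close> to the one vector \<open>x\<close> orthogonal to the null space for which \<open>S x\<close>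
  is the orthogonal projection of \<open>y\<close> to the range. It is bounded because \<open>x\<close> is the shortest
  preimage of \<open>S x\<close>.\<close>

lemma moore_penrose_exists:
  fixes S :: "'a::chilbert_space \<Rightarrow> 'b::chilbert_space"
  assumes S: "bounded_clinear S" and cl: "closed (range S)"
  shows "\<exists>X. moore_penrose S X"
proof -
  interpret S: bounded_linear S using S by (simp add: bounded_clinear_def)
  have SC: "S (c *\<^sub>C x) = c *\<^sub>C S x" for c x using S by (simp add: bounded_clinear_def)
  have C0: "c *\<^sub>C (0::'b) = 0" for c by (metis SC S.zero scaleC_add_right add_cancel_left_left)
  have C_diff: "c *\<^sub>C (v - w) = c *\<^sub>C v - c *\<^sub>C w" for c and v w :: 'b
    by (metis add_diff_cancel diff_add_cancel scaleC_add_right)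
  \<comment> \<open>\<open>D y x\<close> is the description of the value \<open>x\<close> at \<open>y\<close>; all properties of \<open>X\<close> are derived from
    it and from uniqueness.\<close>
  define D where "D y x \<longleftrightarrow> (\<forall>n. S n = 0 \<longrightarrow> x \<bullet> n = 0) \<and> (\<forall>w. S w \<bullet> (y - S x) = 0)" for y x
  have ex: "\<exists>x. D y x" for y
  proof -
    have "subspace (range S)" by (simp add: S.linear_axioms linear_subspace_image)
    then obtain p where p: "p \<in> range S" "\<And>v. v \<in> range S \<Longrightarrow> v \<bullet> y = v \<bullet> p"
      using riesz_on_closed_subspace[OF cl _ bounded_linear_inner_left] by blast
    then obtain x0 where x0: "p = S x0" by blast
    have "subspace {n. S n = 0}" by (auto simp: subspace_def S.add S.scaleR S.zero)
    moreover have "closed {n. S n = 0}"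
      by (intro closed_Collect_eq S.continuous_on continuous_intros)
    ultimately obtain m where m: "m \<in> {n. S n = 0}"
        "\<And>n. n \<in> {n. S n = 0} \<Longrightarrow> n \<bullet> x0 = n \<bullet> m"
      using riesz_on_closed_subspace[OF _ _ bounded_linear_inner_left] by blast
    have "S w \<bullet> (y - S (x0 - m)) = 0" for w
      using p(2)[of "S w"] m(1) by (simp add: inner_diff_right S.diff x0)
    moreover have "(x0 - m) \<bullet> n = 0" if "S n = 0" for n
      using m(2)[of n] that by (simp add: inner_commute[of _ n] inner_diff_right)
    ultimately have "D y (x0 - m)" by (simp add: D_def)
    then show ?thesis by blast
  qed
  have uniq: "x = x'" if "D y x" "D y x'" for y x x'
  proof -
    have "S (x - x') \<bullet> S (x - x') = S (x - x') \<bullet> (y - S x') - S (x - x') \<bullet> (y - S x)"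
      by (simp add: S.diff inner_diff_right)
    also have "\<dots> = 0" using that by (simp add: D_def)
    finally have "S (x - x') = 0" by simp
    then have "(x - x') \<bullet> (x - x') = 0" using that by (simp add: D_def inner_diff_left)
    then show ?thesis by simp
  qed
  obtain X where X: "\<And>y. D y (X y)" using ex by metis
  have XI: "X y = x" if "D y x" for y x using uniq[OF X that] .
  obtain K0 where K0: "\<And>y. y \<in> range S \<Longrightarrow> \<exists>x. S x = y \<and> norm x \<le> K0 * norm y"
    using closed_range_bounded_preimages[OF S.bounded_linear_axioms cl] by blast
  \<comment> \<open>The bound for preimages may be negative if the range is trivial.\<close>
  define K where "K = max K0 0"
  have K: "\<exists>x'. S x' = S x \<and> norm x' \<le> K * norm (S x)" for x
  proof -
    have "K0 * norm (S x) \<le> K * norm (S x)" by (simp add: K_def mult_right_mono)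
    then show ?thesis using K0[of "S x"] by (meson order_trans rangeI)
  qed
  have proj: "S (X y) \<bullet> y = S (X y) \<bullet> S (X y)" for y
    using X[of y] by (auto simp: D_def inner_diff_right)
  have bound: "norm (X y) \<le> norm y * K" for y
  proof -
    obtain x' where x': "S x' = S (X y)" "norm x' \<le> K * norm (S (X y))" using K by blast
    have "S (X y - x') = 0" using x'(1) by (simp add: S.diff)
    then have "X y \<bullet> X y = X y \<bullet> x'" using X[of y] by (auto simp: D_def inner_diff_right)
    then have "norm (X y) * norm (X y) \<le> norm (X y) * norm x'"
      by (metis norm_cauchy_schwarz power2_eq_square power2_norm_eq_inner)
    then have "norm (X y) \<le> norm x'"
      by (cases "X y = 0") auto
    moreover have "norm (S (X y)) * norm (S (X y)) \<le> norm (S (X y)) * norm y"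
      by (metis norm_cauchy_schwarz power2_eq_square power2_norm_eq_inner proj)
    then have "norm (S (X y)) \<le> norm y"
      by (cases "S (X y) = 0") auto
    then have "K * norm (S (X y)) \<le> K * norm y" by (simp add: K_def mult_left_mono)
    ultimately show ?thesis using x'(2) by (simp add: mult.commute)
  qed
  have XC: "X (c *\<^sub>C y) = c *\<^sub>C X y" for c y
  proof (rule XI)
    have "S (cnj c *\<^sub>C n) = 0" if "S n = 0" for n by (simp add: SC that C0)
    moreover have "S w \<bullet> (c *\<^sub>C y - S (c *\<^sub>C X y)) = S (cnj c *\<^sub>C w) \<bullet> (y - S (X y))" for w
      by (simp add: SC inner_scaleC_left C_diff)
    ultimately show "D (c *\<^sub>C y) (c *\<^sub>C X y)"
      using X[of y] by (simp add: D_def inner_scaleC_left)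
  qed
  have "bounded_linear X"
  proof (rule bounded_linear_intro)
    show "X (y + z) = X y + X z" for y z
      using X[of y] X[of z]
      by (intro XI) (simp add: D_def inner_simps S.add)
    show "X (r *\<^sub>R y) = r *\<^sub>R X y" for r y
      using XC[of "complex_of_real r" y] by (simp add: scaleC_of_real)
  qed (rule bound)
  with XC have Xl: "bounded_clinear X" by (simp add: bounded_clinear_def)
  have SXS: "S (X (S x)) = S x" for x
  proof -
    have "S (x - X (S x)) \<bullet> S (x - X (S x)) = 0"
      using X[of "S x"] unfolding D_def S.diff[of x "X (S x)"] by (metis S.diff)
    then show ?thesis by (simp add: S.diff)
  qed
  have XSX: "X (S (X y)) = X y" for y
    using X[of y] by (intro XI) (simp add: D_def)
  have "S (X y) \<bullet> y' = S (X y) \<bullet> S (X y')" for y y'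
    using X[of y'] by (auto simp: D_def inner_diff_right)
  then have symSX: "S (X y) \<bullet> y' = y \<bullet> S (X y')" for y y'
    by (metis inner_commute)
  have "X (S x) \<bullet> x' = X (S x) \<bullet> X (S x')" for x x'
  proof -
    have "S (x' - X (S x')) = 0" by (simp add: S.diff SXS)
    then show ?thesis using X[of "S x"] by (auto simp: D_def inner_diff_right)
  qed
  then have symXS: "X (S x) \<bullet> x' = x \<bullet> X (S x')" for x x'
    by (metis inner_commute)
  have "adj (S \<circ> X) = S \<circ> X"
    by (rule adj_eqI[OF bounded_clinear_compose[OF S Xl]]) (simp add: symSX)
  moreover have "adj (X \<circ> S) = X \<circ> S"
    by (rule adj_eqI[OF bounded_clinear_compose[OF Xl S]]) (simp add: symXS)
  ultimately show ?thesis
    using Xl SXS XSX by (auto simp: moore_penrose_def fun_eq_iff)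
qed

lemma moore_penrose_mp_inverse:
  fixes S :: "'a::chilbert_space \<Rightarrow> 'b::chilbert_space"
  assumes "bounded_clinear S" and "closed (range S)"
  shows "moore_penrose S (S\<^sup>\<dagger>)"
proof -
  have "\<exists>!X. moore_penrose S X"
    using moore_penrose_exists[OF assms] moore_penrose_unique[OF assms(1)] by (rule ex_ex1I)
  then show ?thesis
    unfolding mp_inverse_def by (rule theI')
qed

section \<open>EP operators and full rank factorizations\<close>

lemma null_space_adj:
  fixes S :: "'a::chilbert_space \<Rightarrow> 'b::chilbert_space"
  assumes "bounded_clinear S"
  shows "null_space (adj S) = {y. \<forall>x. S x \<bullet> y = 0}"
proof -
  have "adj S y = 0 \<longleftrightarrow> (\<forall>x. x \<bullet> adj S y = 0)" for y
    by (metis inner_eq_zero_iff inner_zero_right)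
  then show ?thesis by (simp add: null_space_def inner_adj[OF assms])
qed

text \<open>Comparison of the null spaces of two orthogonal projections \<open>P\<close> and \<open>Q\<close>.\<close>

lemma projection_null_subset_iff:
  fixes P Q :: "'a::real_inner \<Rightarrow> 'a"
  assumes P: "linear P" and Q: "linear Q" "\<And>x. Q (Q x) = Q x"
  shows "(\<forall>x. Q x = 0 \<longrightarrow> P x = 0) \<longleftrightarrow> (\<forall>x. P (Q x) = P x)"
proof
  assume null: "\<forall>x. Q x = 0 \<longrightarrow> P x = 0"
  show "\<forall>x. P (Q x) = P x"
  proof
    fix x
    have "Q (x - Q x) = 0" by (simp add: linear_diff[OF Q(1)] Q(2))
    with null have "P (x - Q x) = 0" by blast
    then show "P (Q x) = P x" by (simp add: linear_diff[OF P])
  qed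
next
  assume "\<forall>x. P (Q x) = P x"
  then show "\<forall>x. Q x = 0 \<longrightarrow> P x = 0" by (metis linear_0[OF P])
qed

lemma projection_absorb_commute:
  fixes P Q :: "'a::real_inner \<Rightarrow> 'a"
  assumes P: "\<And>x y. P x \<bullet> y = x \<bullet> P y" and Q: "\<And>x y. Q x \<bullet> y = x \<bullet> Q y"
  shows "(\<forall>x. P (Q x) = P x) \<longleftrightarrow> (\<forall>x. Q (P x) = P x)"
proof -
  have "(\<forall>x. P (Q x) = P x) \<longleftrightarrow> (\<forall>x y. y \<bullet> P (Q x) = y \<bullet> P x)"
    by (metis vector_eq_ldot)
  also have "\<dots> \<longleftrightarrow> (\<forall>x y. Q (P y) \<bullet> x = P y \<bullet> x)"
    by (simp add: P Q)
  also have "\<dots> \<longleftrightarrow> (\<forall>x. Q (P x) = P x)"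
    by (metis vector_eq_rdot)
  finally show ?thesis .
qed

theorem theorem5p3:
  fixes T :: "'h::chilbert_space \<Rightarrow> 'h"
    and B :: "'k::chilbert_space \<Rightarrow> 'h"
    and C :: "'h \<Rightarrow> 'k"
  assumes "bounded_clinear T" and "closed (range T)"
    and "bounded_clinear B" and "inj B" and "closed (range B)"
    and "bounded_clinear C" and "surj C"
    and "T = B \<circ> C"
  shows "(EP T \<longleftrightarrow> B = C\<^sup>\<dagger> \<circ> C \<circ> B \<and> C = C \<circ> B \<circ> B\<^sup>\<dagger>) \<and>
         (EP T \<longleftrightarrow> B\<^sup>\<dagger> = B\<^sup>\<dagger> \<circ> C\<^sup>\<dagger> \<circ> C \<and> C = C \<circ> B \<circ> B\<^sup>\<dagger>) \<and>
         (EP T \<longleftrightarrow> B = C\<^sup>\<dagger> \<circ> C \<circ> B \<and> C\<^sup>\<dagger> = B \<circ> B\<^sup>\<dagger> \<circ> C\<^sup>\<dagger>) \<and>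
         (EP T \<longleftrightarrow> B\<^sup>\<dagger> = B\<^sup>\<dagger> \<circ> C\<^sup>\<dagger> \<circ> C \<and> C\<^sup>\<dagger> = B \<circ> B\<^sup>\<dagger> \<circ> C\<^sup>\<dagger>)"
proof -
  interpret B: bounded_linear B using assms(3) by (simp add: bounded_clinear_def)
  interpret C: bounded_linear C using assms(6) by (simp add: bounded_clinear_def)
  have clC: "closed (range C)" using \<open>surj C\<close> by simp
  note b = moore_penrose_props[OF assms(3) moore_penrose_mp_inverse[OF assms(3,5)]]
  note c = moore_penrose_props[OF assms(6) moore_penrose_mp_inverse[OF assms(6) clC]]
  interpret B': bounded_linear "B\<^sup>\<dagger>" using b(1) by (simp add: bounded_clinear_def)
  interpret C': bounded_linear "C\<^sup>\<dagger>" using c(1) by (simp add: bounded_clinear_def)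
  \<comment> \<open>The orthogonal projections to the range of \<open>B\<close> and to the orthogonal complement of
    the null space of \<open>C\<close>.\<close>
  define P where "P x = B ((B\<^sup>\<dagger>) x)" for x
  define Q where "Q x = (C\<^sup>\<dagger>) (C x)" for x
  have linP: "linear P" and linQ: "linear Q"
    by (auto intro!: linearI simp: P_def Q_def B.add B.scaleR B'.add B'.scaleR
        C.add C.scaleR C'.add C'.scaleR)
  have idP: "P (P x) = P x" and idQ: "Q (Q x) = Q x" for x
    by (simp_all add: P_def Q_def b c)
  have symP: "P x \<bullet> y = x \<bullet> P y" and symQ: "Q x \<bullet> y = x \<bullet> Q y" for x y
    unfolding P_def Q_def by (rule b(4), rule c(5))
  have PB: "P (B x) = B x" and B'P: "(B\<^sup>\<dagger>) (P y) = (B\<^sup>\<dagger>) y" for x y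
    by (simp_all add: P_def b)
  have CQ: "C (Q y) = C y" and QC': "Q ((C\<^sup>\<dagger>) x) = (C\<^sup>\<dagger>) x" for x y
    by (simp_all add: Q_def c)

  have nullT: "null_space T = {x. Q x = 0}"
  proof -
    have "B (C x) = 0 \<longleftrightarrow> C x = 0" for x using \<open>inj B\<close> B.zero by (metis injD)
    moreover have "C x = 0 \<longleftrightarrow> Q x = 0" for x by (metis CQ C.zero C'.zero Q_def)
    ultimately show ?thesis by (simp add: null_space_def \<open>T = B \<circ> C\<close>)
  qed
  have nullT': "null_space (adj T) = {y. P y = 0}"
  proof -
    have "(\<forall>x. B (C x) \<bullet> y = 0) \<longleftrightarrow> (\<forall>w. B w \<bullet> y = 0)" for y
      using \<open>surj C\<close> by (metis surjD)
    also have "(\<forall>w. B w \<bullet> y = 0) \<longleftrightarrow> P y = 0" for y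
    proof
      assume "\<forall>w. B w \<bullet> y = 0"
      then have "P (P y) \<bullet> y = 0" unfolding P_def by blast
      then have "P y \<bullet> P y = 0" by (simp add: symP)
      then show "P y = 0" by simp
    next
      assume "P y = 0"
      then show "\<forall>w. B w \<bullet> y = 0" by (metis PB symP inner_zero_right)
    qed
    finally show ?thesis
      unfolding null_space_adj[OF assms(1)] by (simp add: \<open>T = B \<circ> C\<close>)
  qed
  have EP: "EP T \<longleftrightarrow> (\<forall>x. Q x = 0 \<longrightarrow> P x = 0) \<and> (\<forall>x. P x = 0 \<longrightarrow> Q x = 0)"
    using assms(1,2) by (auto simp: EP_def nullT nullT')

  have subQP: "(\<forall>x. Q x = 0 \<longrightarrow> P x = 0) \<longleftrightarrow> (\<forall>x. P (Q x) = P x)"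
    by (rule projection_null_subset_iff[OF linP linQ idQ])
  have subPQ: "(\<forall>x. P x = 0 \<longrightarrow> Q x = 0) \<longleftrightarrow> (\<forall>x. Q (P x) = Q x)"
    by (rule projection_null_subset_iff[OF linQ linP idP])
  have PQ: "(\<forall>x. P (Q x) = P x) \<longleftrightarrow> (\<forall>x. Q (P x) = P x)"
    using symP symQ by (rule projection_absorb_commute)
  have QP: "(\<forall>x. Q (P x) = Q x) \<longleftrightarrow> (\<forall>x. P (Q x) = Q x)"
    using symQ symP by (rule projection_absorb_commute)

  have 1: "B = C\<^sup>\<dagger> \<circ> C \<circ> B \<longleftrightarrow> (\<forall>x. Q x = 0 \<longrightarrow> P x = 0)"
  proof -
    have "B = C\<^sup>\<dagger> \<circ> C \<circ> B \<longleftrightarrow> (\<forall>x. Q (B x) = B x)" by (auto simp: fun_eq_iff Q_def)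
    also have "\<dots> \<longleftrightarrow> (\<forall>x. Q (P x) = P x)" by (metis PB P_def)
    finally show ?thesis by (simp add: subQP PQ)
  qed
  have 2: "B\<^sup>\<dagger> = B\<^sup>\<dagger> \<circ> C\<^sup>\<dagger> \<circ> C \<longleftrightarrow> (\<forall>x. Q x = 0 \<longrightarrow> P x = 0)"
  proof -
    have "B\<^sup>\<dagger> = B\<^sup>\<dagger> \<circ> C\<^sup>\<dagger> \<circ> C \<longleftrightarrow> (\<forall>x. (B\<^sup>\<dagger>) (Q x) = (B\<^sup>\<dagger>) x)" by (auto simp: fun_eq_iff Q_def)
    also have "\<dots> \<longleftrightarrow> (\<forall>x. P (Q x) = P x)" by (metis B'P P_def)
    finally show ?thesis by (simp add: subQP)
  qed
  have 3: "C = C \<circ> B \<circ> B\<^sup>\<dagger> \<longleftrightarrow> (\<forall>x. P x = 0 \<longrightarrow> Q x = 0)"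
  proof -
    have "C = C \<circ> B \<circ> B\<^sup>\<dagger> \<longleftrightarrow> (\<forall>x. C (P x) = C x)" by (auto simp: fun_eq_iff P_def)
    also have "\<dots> \<longleftrightarrow> (\<forall>x. Q (P x) = Q x)" by (metis CQ Q_def)
    finally show ?thesis by (simp add: subPQ)
  qed
  have 4: "C\<^sup>\<dagger> = B \<circ> B\<^sup>\<dagger> \<circ> C\<^sup>\<dagger> \<longleftrightarrow> (\<forall>x. P x = 0 \<longrightarrow> Q x = 0)"
  proof -
    have "C\<^sup>\<dagger> = B \<circ> B\<^sup>\<dagger> \<circ> C\<^sup>\<dagger> \<longleftrightarrow> (\<forall>x. P ((C\<^sup>\<dagger>) x) = (C\<^sup>\<dagger>) x)" by (auto simp: fun_eq_iff P_def)
    also have "\<dots> \<longleftrightarrow> (\<forall>x. P (Q x) = Q x)" by (metis QC' Q_def)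
    finally show ?thesis by (simp add: subPQ QP)
  qed
  show ?thesis by (simp only: EP 1 2 3 4 simp_thms)
qed

end
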